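(* There exists an atomic Puiseux monoid $M$ such that its power monoid $\mathcal{P}_{\mathrm{fin}}(M)$ is not atomic.
   Context: All monoids are commutative semigroups with identity, written additively with identity $0$. A Puiseux monoid is a submonoid of $(\mathbb{Q}_{\ge 0},+)$. For a monoid $M$, the (finitary) power monoid $\mathcal{P}_{\mathrm{fin}}(M)$ is the set of all nonempty finite subsets of $M$ with operation $S+T := \{s+t \mid s\in S,\ t\in T\}$; its identity is $\{0\}$. For a monoid $N$, let $N^\times$ be its group of invertible elements. An element $a\in N\setminus N^\times$ is an atom if whenever $a=r+s$ with $r,s\in N$, either $r\in N^\times$ or $s\in N^\times$. The monoid $N$ is atomic if every non-invertible element of $N$ is a finite sum of atoms. *)

theory Defs
  imports "HOL-Algebra.Coset" "HOL.Rat"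
begin

(* Monoids are HOL-Algebra monoid records; the library's multiplicative notation
   is used for the additively written operation. *)

(* This is not the library's irreducible: that notion is defined through proper
   divisors, and in a non-cancellative monoid such as a power monoid it can differ
   from the following one. *)
definition monoid_atom :: "('a, 'b) monoid_scheme \<Rightarrow> 'a \<Rightarrow> bool" where
  "monoid_atom N a \<longleftrightarrow> a \<in> carrier N - Units N \<and>
     (\<forall>r \<in> carrier N. \<forall>s \<in> carrier N. a = r \<otimes>\<^bsub>N\<^esub> s \<longrightarrow> r \<in> Units N \<or> s \<in> Units N)"

definition atomic_monoid :: "('a, 'b) monoid_scheme \<Rightarrow> bool" where
  "atomic_monoid N \<longleftrightarrow>
     (\<forall>x \<in> carrier N - Units N.
        \<exists>as. (\<forall>a \<in> set as. monoid_atom N a) \<and> x = foldr (\<otimes>\<^bsub>N\<^esub>) as \<one>\<^bsub>N\<^esub>)"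

definition power_monoid :: "('a, 'b) monoid_scheme \<Rightarrow> 'a set monoid" where
  "power_monoid M =
     \<lparr>carrier = {S. S \<subseteq> carrier M \<and> finite S \<and> S \<noteq> {}},
      mult = (\<lambda>S T. S <#>\<^bsub>M\<^esub> T),
      one = {\<one>\<^bsub>M\<^esub>}\<rparr>"

definition nonneg_rat_monoid :: "rat monoid" where
  "nonneg_rat_monoid = \<lparr>carrier = {q. 0 \<le> q}, mult = (+), one = 0\<rparr>"

definition puiseux_monoid :: "rat monoid \<Rightarrow> bool" where
  "puiseux_monoid M \<longleftrightarrow>
     (\<exists>H. submonoid H nonneg_rat_monoid \<and> M = nonneg_rat_monoid\<lparr>carrier := H\<rparr>)"

lemma comm_monoid_nonneg_rat_monoid: "comm_monoid nonneg_rat_monoid"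
  by unfold_locales (auto simp: nonneg_rat_monoid_def)

lemma puiseux_monoid_imp_comm_monoid:
  assumes "puiseux_monoid M"
  shows "comm_monoid M"
proof -
  obtain H where H: "submonoid H nonneg_rat_monoid" "M = nonneg_rat_monoid\<lparr>carrier := H\<rparr>"
    using assms by (auto simp: puiseux_monoid_def)
  have "monoid M"
    using H submonoid.submonoid_is_monoid comm_monoid.axioms(1)[OF comm_monoid_nonneg_rat_monoid]
    by blast
  then show ?thesis
    by (rule monoid.monoid_comm_monoidI) (auto simp: H(2) nonneg_rat_monoid_def)
qed

lemma comm_monoid_power_monoid:
  assumes "comm_monoid M"
  shows "comm_monoid (power_monoid M)"
proof -
  interpret comm_monoid M by fact
  have closed: "S <#>\<^bsub>M\<^esub> T \<subseteq> carrier M \<and> finite (S <#>\<^bsub>M\<^esub> T) \<and> S <#>\<^bsub>M\<^esub> T \<noteq> {}"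
    if "S \<subseteq> carrier M" "finite S" "S \<noteq> {}" "T \<subseteq> carrier M" "finite T" "T \<noteq> {}" for S T
    using that by (auto simp: set_mult_def)
  have assoc: "S <#>\<^bsub>M\<^esub> T <#>\<^bsub>M\<^esub> U = S <#>\<^bsub>M\<^esub> (T <#>\<^bsub>M\<^esub> U)"
    if "S \<subseteq> carrier M" "T \<subseteq> carrier M" "U \<subseteq> carrier M" for S T U
  proof -
    have "x \<otimes>\<^bsub>M\<^esub> y \<otimes>\<^bsub>M\<^esub> z = x \<otimes>\<^bsub>M\<^esub> (y \<otimes>\<^bsub>M\<^esub> z)" if "x \<in> S" "y \<in> T" "z \<in> U" for x y z
      using that \<open>S \<subseteq> _\<close> \<open>T \<subseteq> _\<close> \<open>U \<subseteq> _\<close> m_assoc by blast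
    then show ?thesis by (simp add: set_mult_def)
  qed
  have comm_subset: "S <#>\<^bsub>M\<^esub> T \<subseteq> T <#>\<^bsub>M\<^esub> S"
    if "S \<subseteq> carrier M" "T \<subseteq> carrier M" for S T
  proof
    fix z assume "z \<in> S <#>\<^bsub>M\<^esub> T"
    then obtain x y where "x \<in> S" "y \<in> T" "z = x \<otimes>\<^bsub>M\<^esub> y"
      by (auto simp: set_mult_def)
    moreover from this that have "z = y \<otimes>\<^bsub>M\<^esub> x"
      using m_comm by blast
    ultimately show "z \<in> T <#>\<^bsub>M\<^esub> S"
      unfolding set_mult_def by blast
  qed
  have comm: "S <#>\<^bsub>M\<^esub> T = T <#>\<^bsub>M\<^esub> S" if "S \<subseteq> carrier M" "T \<subseteq> carrier M" for S T
    using that comm_subset by (intro equalityI) auto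
  have unit: "{\<one>\<^bsub>M\<^esub>} <#>\<^bsub>M\<^esub> S = S" if "S \<subseteq> carrier M" for S
  proof -
    have "\<one>\<^bsub>M\<^esub> \<otimes>\<^bsub>M\<^esub> x = x" if "x \<in> S" for x
      using that \<open>S \<subseteq> _\<close> by (meson l_one subsetD)
    then show ?thesis by (simp add: set_mult_def)
  qed
  have "monoid (power_monoid M)"
  proof (rule monoidI)
    fix S assume "S \<in> carrier (power_monoid M)"
    then have "S \<subseteq> carrier M"
      by (simp add: power_monoid_def)
    then show "S \<otimes>\<^bsub>power_monoid M\<^esub> \<one>\<^bsub>power_monoid M\<^esub> = S"
      using comm[of S "{\<one>\<^bsub>M\<^esub>}"] unit[of S] one_closed by (simp add: power_monoid_def)
  qed (simp_all add: power_monoid_def closed assoc unit)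
  moreover have "S \<otimes>\<^bsub>power_monoid M\<^esub> T = T \<otimes>\<^bsub>power_monoid M\<^esub> S"
    if "S \<in> carrier (power_monoid M)" "T \<in> carrier (power_monoid M)" for S T
    using that comm[of S T] by (simp add: power_monoid_def)
  ultimately show ?thesis
    by (rule monoid.monoid_comm_monoidI)
qed

end

theory Submission
  imports Defs "HOL-Computational_Algebra.Primes" "HOL-Library.Countable_Set"
begin

text \<open>
  If a pair of elements \<open>a \<noteq> b\<close> of a Puiseux monoid is a sum of atoms of the power monoid, then all
  but one of the summands are singletons, because two sets with at least two elements each have a
  sum with at least three. The one remaining atom is a translate of \<open>{a, b}\<close>, and the
  translation is by a maximal common divisor of \<open>a\<close> and \<open>b\<close> (lemma \<open>pair_sum_of_atoms_imp_mcd\<close>).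
  So it suffices to find an atomic Puiseux monoid with two elements that have no maximal common
  divisor.

  Without atomicity this is easy: let \<open>N\<close> consist of the nonnegative elements of \<open>\<int>[1/3]\<close> and of
  the elements of the coset \<open>1/2 + \<int>[1/3]\<close> that are strictly greater than \<open>1/2\<close>. The common
  divisors of \<open>1\<close> and \<open>3/2\<close> are the elements of \<open>\<int>[1/3]\<close> in \<open>[0, 1)\<close>, and none of them is
  maximal (lemma \<open>half_gap_no_mcd\<close>).

  Atomicity is then forced by dividing generators by primes. Enumerate the nonzero
  elements of \<open>N\<close> as \<open>y\<^sub>0, y\<^sub>1, \<dots>\<close>, choose distinct primes \<open>p\<^sub>i\<close> that divide no denominator in \<open>N\<close>
  and do not divide the numerator of \<open>y\<^sub>i\<close>, and let \<open>M\<close> be generated by the fractions \<open>y\<^sub>i / p\<^sub>i\<close>.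
  Only the \<open>i\<close>-th generator has \<open>p\<^sub>i\<close> in its denominator, so each generator is an atom
  and \<open>M\<close> is atomic (lemma \<open>gen_atom\<close>). On the other hand
  \<open>M\<close> contains \<open>N\<close>, and a sum of generators can lie in \<open>N\<close> only if
  the multiplicity of each \<open>y\<^sub>i / p\<^sub>i\<close> is a multiple of \<open>p\<^sub>i\<close>. If now \<open>d\<close> is a common divisor of
  \<open>a, b \<in> N\<close> in \<open>M\<close>, then the multiplicities of each generator in \<open>a - d\<close> and in \<open>b - d\<close> are congruent
  modulo \<open>p\<^sub>i\<close>. Either a generator occurs in both, and \<open>d\<close> is not maximal, or all
  the multiplicities are divisible by their primes, and \<open>d\<close>, \<open>a - d\<close>, \<open>b - d\<close> lie in \<open>N\<close>
  (lemma \<open>common_divisor_cases\<close>). Thus the pair \<open>1, 3/2\<close> has no maximal common divisor in \<open>M\<close> either.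
\<close>

section \<open>Pairs in the power monoid of a Puiseux monoid\<close>

abbreviation puiseux :: "rat set \<Rightarrow> rat monoid" where
  "puiseux H \<equiv> nonneg_rat_monoid\<lparr>carrier := H\<rparr>"

lemma Units_puiseux:
  assumes "submonoid H nonneg_rat_monoid"
  shows "Units (puiseux H) = {0}"
proof
  have Units: "x \<in> Units (puiseux H) \<longleftrightarrow> x \<in> H \<and> (\<exists>z\<in>H. z + x = 0 \<and> x + z = 0)" for x
    by (simp add: Units_def nonneg_rat_monoid_def)
  show "Units (puiseux H) \<subseteq> {0}"
  proof
    fix x assume "x \<in> Units (puiseux H)"
    then obtain z where "x \<in> H" "z \<in> H" "z + x = 0"
      using Units by blast
    moreover from this have "x \<ge> 0" "z \<ge> 0"
      using submonoid.subset[OF assms] by (auto simp: nonneg_rat_monoid_def)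
    ultimately show "x \<in> {0}"
      by simp
  qed
  have "0 \<in> H"
    using submonoid.one_closed[OF assms] by (simp add: nonneg_rat_monoid_def)
  then have "0 \<in> Units (puiseux H)"
    unfolding Units by (intro conjI bexI[of _ 0]) simp_all
  then show "{0} \<subseteq> Units (puiseux H)"
    by simp
qed

lemma puiseux_sum_eq_zeroD:
  assumes "submonoid H nonneg_rat_monoid" "S \<subseteq> H" "T \<subseteq> H" "T \<noteq> {}" "S \<noteq> {}"
    and "S <#>\<^bsub>puiseux H\<^esub> T = {0}"
  shows "S = {0}"
proof -
  have "s = 0" if "s \<in> S" for s
  proof -
    obtain t where "t \<in> T"
      using assms by auto
    with that have "s + t \<in> S <#>\<^bsub>puiseux H\<^esub> T"
      by (auto simp: set_mult_def nonneg_rat_monoid_def)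
    then have "s + t = 0"
      using assms by auto
    moreover have "s \<ge> 0" "t \<ge> 0"
      using submonoid.subset[OF assms(1)] assms that \<open>t \<in> T\<close> by (auto simp: nonneg_rat_monoid_def)
    ultimately show ?thesis by simp
  qed
  then show ?thesis
    using assms by auto
qed

lemma Units_power_puiseux:
  assumes "submonoid H nonneg_rat_monoid"
  shows "Units (power_monoid (puiseux H)) = {{0}}"
proof
  show "Units (power_monoid (puiseux H)) \<subseteq> {{0}}"
  proof
    fix S assume "S \<in> Units (power_monoid (puiseux H))"
    then obtain T where "S \<subseteq> H" "S \<noteq> {}" "T \<subseteq> H" "T \<noteq> {}" "S <#>\<^bsub>puiseux H\<^esub> T = {0}"
      by (auto simp: Units_def power_monoid_def nonneg_rat_monoid_def)
    then show "S \<in> {{0}}"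
      using puiseux_sum_eq_zeroD[OF assms] by blast
  qed
  have "{0} <#>\<^bsub>puiseux H\<^esub> {0} = {0}"
    by (simp add: set_mult_def nonneg_rat_monoid_def)
  then show "{{0}} \<subseteq> Units (power_monoid (puiseux H))"
    using submonoid.one_closed[OF assms]
    by (auto simp: Units_def power_monoid_def nonneg_rat_monoid_def)
qed

lemma sum_of_two_nonsingletons:
  fixes S T :: "rat set"
  assumes "s \<in> S" "s' \<in> S" "s \<noteq> s'" "t \<in> T" "t' \<in> T" "t \<noteq> t'"
    and "S <#>\<^bsub>puiseux H\<^esub> T = {a, b}"
  shows False
proof -
  have sum: "u = a \<or> u = b" if "u1 \<in> S" "u2 \<in> T" "u = u1 + u2" for u u1 u2
  proof -
    have "u \<in> S <#>\<^bsub>puiseux H\<^esub> T"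
      using that by (auto simp: set_mult_def nonneg_rat_monoid_def)
    then show ?thesis
      unfolding assms(7) by blast
  qed
  have *: False if "s1 \<in> S" "s2 \<in> S" "s1 < s2" "t1 \<in> T" "t2 \<in> T" "t1 < t2" for s1 s2 t1 t2
  proof -
    have "s1 + t1 < s1 + t2" "s1 + t2 < s2 + t2"
      using that by simp_all
    moreover have "s1 + t1 = a \<or> s1 + t1 = b" "s1 + t2 = a \<or> s1 + t2 = b"
      "s2 + t2 = a \<or> s2 + t2 = b"
      using that sum by simp_all
    ultimately show False
      by (elim disjE) simp_all
  qed
  have "s < s' \<or> s' < s" "t < t' \<or> t' < t"
    using assms(3,6) by (simp_all add: neq_iff)
  then show False
    using *[OF assms(1,2) _ assms(4,5)] *[OF assms(1,2) _ assms(5,4)]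
      *[OF assms(2,1) _ assms(4,5)] *[OF assms(2,1) _ assms(5,4)] by argo
qed

text \<open>
  The statement speaks of an arbitrary pair, so that in the induction over the summands a
  singleton first summand can be subtracted.
\<close>

lemma pair_sum_of_atoms_translate:
  assumes H: "submonoid H nonneg_rat_monoid"
    and "\<forall>A \<in> set As. monoid_atom (power_monoid (puiseux H)) A"
    and "{a, b} = foldr (\<otimes>\<^bsub>power_monoid (puiseux H)\<^esub>) As \<one>\<^bsub>power_monoid (puiseux H)\<^esub>"
    and "a \<noteq> b"
  shows "\<exists>d a' b'. d \<in> H \<and> monoid_atom (power_monoid (puiseux H)) {a', b'} \<and>
           a = d + a' \<and> b = d + b'"
  using assms(2-)
proof (induction As arbitrary: a b)
  case Nil
  then show ?case
    by (auto simp: power_monoid_def doubleton_eq_iff)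
next
  case (Cons A As)
  let ?P = "power_monoid (puiseux H)"
  define T where "T = foldr (\<otimes>\<^bsub>?P\<^esub>) As \<one>\<^bsub>?P\<^esub>"
  interpret P: comm_monoid ?P
    using comm_monoid_power_monoid puiseux_monoid_imp_comm_monoid H
    unfolding puiseux_monoid_def by blast
  have "A \<in> carrier ?P"
    using Cons.prems by (auto simp: monoid_atom_def)
  then have A: "A \<subseteq> H" "A \<noteq> {}"
    by (auto simp: power_monoid_def)
  have "set As \<subseteq> carrier ?P"
    using Cons.prems by (auto simp: monoid_atom_def)
  then have "T \<in> carrier ?P"
    unfolding T_def by (induction As) auto
  then have T: "T \<subseteq> H" "T \<noteq> {}"
    by (auto simp: power_monoid_def)
  have AT: "A <#>\<^bsub>puiseux H\<^esub> T = {a, b}"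
    using Cons.prems by (simp add: T_def power_monoid_def)
  consider t where "T = {t}" | s where "A = {s}"
    using sum_of_two_nonsingletons[OF _ _ _ _ _ _ AT] A T by blast
  then show ?case
  proof cases
    case 1
    have "A = {a - t, b - t}"
    proof -
      have "(\<lambda>s. s + t) ` A = {a, b}"
        using AT 1 by (auto simp: set_mult_def nonneg_rat_monoid_def)
      then have "(\<lambda>x. x - t) ` (\<lambda>s. s + t) ` A = {a - t, b - t}"
        by simp
      then show ?thesis by (simp add: image_image)
    qed
    then have "monoid_atom ?P {a - t, b - t}"
      using Cons.prems(1) by simp
    moreover have "t \<in> H"
      using T 1 by simp
    ultimately show ?thesis
      by (intro exI[of _ t] exI[of _ "a - t"] exI[of _ "b - t"]) simp
  next
    case 2
    have "T = {a - s, b - s}"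
    proof -
      have "(\<lambda>t. s + t) ` T = {a, b}"
        using AT 2 by (auto simp: set_mult_def nonneg_rat_monoid_def)
      then have "(\<lambda>x. x - s) ` (\<lambda>t. s + t) ` T = {a - s, b - s}"
        by simp
      then show ?thesis by (simp add: image_image)
    qed
    then have "{a - s, b - s} = foldr (\<otimes>\<^bsub>?P\<^esub>) As \<one>\<^bsub>?P\<^esub>"
      by (simp only: T_def)
    moreover have "\<forall>A \<in> set As. monoid_atom ?P A" "a - s \<noteq> b - s"
      using Cons.prems by simp_all
    ultimately obtain d a' b' where
      d: "d \<in> H" "monoid_atom ?P {a', b'}" "a - s = d + a'" "b - s = d + b'"
      using Cons.IH[of "a - s" "b - s"] by blast
    have "s + d \<in> H"
      using submonoid.m_closed[OF H, of s d] A 2 d by (simp add: nonneg_rat_monoid_def)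
    then show ?thesis
      using d by (intro exI[of _ "s + d"] exI[of _ a'] exI[of _ b']) (simp add: algebra_simps)
  qed
qed

lemma pair_sum_of_atoms_imp_mcd:
  assumes H: "submonoid H nonneg_rat_monoid"
    and "\<forall>A \<in> set As. monoid_atom (power_monoid (puiseux H)) A"
    and "{a, b} = foldr (\<otimes>\<^bsub>power_monoid (puiseux H)\<^esub>) As \<one>\<^bsub>power_monoid (puiseux H)\<^esub>"
    and "a \<noteq> b"
  obtains d where "d \<in> H" "a - d \<in> H" "b - d \<in> H"
    "\<And>e. e \<in> H \<Longrightarrow> a - d - e \<in> H \<Longrightarrow> b - d - e \<in> H \<Longrightarrow> e = 0"
proof -
  let ?P = "power_monoid (puiseux H)"
  obtain d a' b' where d: "d \<in> H" "monoid_atom ?P {a', b'}" and ab: "a = d + a'" "b = d + b'"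
    using pair_sum_of_atoms_translate[OF assms] by blast
  have carr: "a' \<in> H" "b' \<in> H"
    using d by (auto simp: monoid_atom_def power_monoid_def)
  have "e = 0" if e: "e \<in> H" "a' - e \<in> H" "b' - e \<in> H" for e
  proof -
    have "{a', b'} = {e} \<otimes>\<^bsub>?P\<^esub> {a' - e, b' - e}"
      by (simp add: power_monoid_def set_mult_def nonneg_rat_monoid_def insert_commute)
    moreover have "{e} \<in> carrier ?P" "{a' - e, b' - e} \<in> carrier ?P"
      using e by (auto simp: power_monoid_def)
    ultimately have "{e} \<in> Units ?P \<or> {a' - e, b' - e} \<in> Units ?P"
      using d(2) unfolding monoid_atom_def by blast
    then show ?thesis
      using ab \<open>a \<noteq> b\<close> by (auto simp: Units_power_puiseux[OF H])
  qed
  then show ?thesis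
    using that[of d] d carr ab by simp
qed

section \<open>Rationals without a given prime in the denominator\<close>

definition integral_at :: "nat \<Rightarrow> rat \<Rightarrow> bool" where
  "integral_at q x \<longleftrightarrow> (\<exists>m n. \<not> int q dvd n \<and> x = of_int m / of_int n)"

lemma integral_at_of_int:
  assumes "prime q"
  shows "integral_at q (of_int m)"
  unfolding integral_at_def using assms by (intro exI[of _ m] exI[of _ 1]) auto

lemma integral_at_add:
  assumes "prime q" "integral_at q x" "integral_at q y"
  shows "integral_at q (x + y)"
proof -
  obtain m n m' n' where *: "\<not> int q dvd n" "\<not> int q dvd n'"
    "x = of_int m / of_int n" "y = of_int m' / of_int n'"
    using assms by (auto simp: integral_at_def)
  then have "\<not> int q dvd n * n'" "n \<noteq> 0" "n' \<noteq> 0"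
    using assms(1) by (auto simp: prime_dvd_mult_iff)
  then show ?thesis
    unfolding integral_at_def using *
    by (intro exI[of _ "m * n' + m' * n"] exI[of _ "n * n'"]) (auto simp: field_simps)
qed

lemma integral_at_mult:
  assumes "prime q" "integral_at q x" "integral_at q y"
  shows "integral_at q (x * y)"
proof -
  obtain m n m' n' where *: "\<not> int q dvd n" "\<not> int q dvd n'"
    "x = of_int m / of_int n" "y = of_int m' / of_int n'"
    using assms by (auto simp: integral_at_def)
  then have "\<not> int q dvd n * n'"
    using assms(1) by (auto simp: prime_dvd_mult_iff)
  then show ?thesis
    unfolding integral_at_def using *
    by (intro exI[of _ "m * m'"] exI[of _ "n * n'"]) auto
qed

lemma integral_at_diff:
  assumes "prime q" "integral_at q x" "integral_at q y"
  shows "integral_at q (x - y)"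
  using integral_at_add[OF assms(1,2) integral_at_mult[OF assms(1) integral_at_of_int[OF assms(1), of "-1"] assms(3)]]
  by simp

lemma integral_at_of_nat_divide:
  assumes "prime q"
  shows "integral_at q (of_nat k / of_nat q) \<longleftrightarrow> q dvd k"
proof
  assume "integral_at q (of_nat k / of_nat q)"
  then obtain m n where mn: "\<not> int q dvd n" "of_nat k / of_nat q = (of_int m / of_int n :: rat)"
    by (auto simp: integral_at_def)
  have "n \<noteq> 0" "q \<noteq> 0"
    using mn assms by auto
  then have "of_int (int k * n) = (of_int (m * int q) :: rat)"
    using mn by (simp add: field_simps)
  then have "int k * n = m * int q"
    by (simp only: of_int_eq_iff)
  then have "int q dvd int k * n"
    by simp
  then show "q dvd k"
    using mn assms by (simp add: prime_dvd_mult_iff)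
next
  assume "q dvd k"
  then obtain l where "k = q * l" by blast
  then show "integral_at q (of_nat k / of_nat q)"
    using integral_at_of_int[OF assms, of "int l"] assms by auto
qed

lemma integral_at_inverse:
  assumes "\<not> int q dvd fst (quotient_of x)"
  shows "integral_at q (inverse x)"
proof -
  have "x = of_int (fst (quotient_of x)) / of_int (snd (quotient_of x))"
    by (simp add: quotient_of_div)
  then have "inverse x = of_int (snd (quotient_of x)) / of_int (fst (quotient_of x))"
    by (metis inverse_divide)
  then show ?thesis
    unfolding integral_at_def using assms by blast
qed

section \<open>Dividing generators by distinct primes\<close>

text \<open>
  The last assumption, that \<open>p i\<close> does not divide the numerator of \<open>y i\<close>, is expressed through
  the inverse because then multiplication by \<open>inverse (y i)\<close> preserves integrality at \<open>p i\<close>, which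
  is how multiplicities are read off from a sum of generators.
\<close>

locale prime_divided_generators =
  fixes y :: "nat \<Rightarrow> rat" and p :: "nat \<Rightarrow> nat"
  assumes prime_p: "prime (p i)"
    and inj_p: "inj p"
    and y_pos: "y i > 0"
    and y_integral: "integral_at (p j) (y i)"
    and inverse_y_integral: "integral_at (p i) (inverse (y i))"
begin

definition gen :: "nat \<Rightarrow> rat" where
  "gen i = y i / of_nat (p i)"

text \<open>
  A multiset of indices records a representation as a sum of generators, and
  \<open>count\<close> gives the coefficients.
\<close>

definition gen_sum :: "nat multiset \<Rightarrow> rat" where
  "gen_sum X = (\<Sum>i\<in>#X. gen i)"

definition span :: "rat set" where
  "span = range gen_sum"

lemma gen_pos: "gen i > 0"
  using y_pos[of i] prime_gt_0_nat[OF prime_p[of i]] by (simp add: gen_def)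

lemma gen_sum_simps [simp]:
  "gen_sum {#} = 0" "gen_sum (X + Y) = gen_sum X + gen_sum Y"
  "gen_sum (add_mset i X) = gen i + gen_sum X"
  by (simp_all add: gen_sum_def)

lemma gen_sum_nonneg: "gen_sum X \<ge> 0"
proof (induction X)
  case (add i X)
  then show ?case
    using gen_pos[of i] by simp
qed simp

lemma gen_sum_eq_0_iff: "gen_sum X = 0 \<longleftrightarrow> X = {#}"
proof (cases X)
  case (add i X')
  then show ?thesis
    using gen_pos[of i] gen_sum_nonneg[of X'] by simp
qed simp

lemma submonoid_span: "submonoid span nonneg_rat_monoid"
proof
  show "span \<subseteq> carrier nonneg_rat_monoid"
    using gen_sum_nonneg by (auto simp: span_def nonneg_rat_monoid_def)
  show "x \<otimes>\<^bsub>nonneg_rat_monoid\<^esub> z \<in> span" if "x \<in> span" "z \<in> span" for x z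
    using that unfolding span_def nonneg_rat_monoid_def
    by (auto simp flip: gen_sum_simps(2))
  show "\<one>\<^bsub>nonneg_rat_monoid\<^esub> \<in> span"
    unfolding span_def nonneg_rat_monoid_def by (rule range_eqI[of _ _ "{#}"]) simp
qed

lemma gen_in_span: "gen i \<in> span"
  unfolding span_def by (rule range_eqI[of _ _ "{#i#}"]) simp

lemma gen_sum_replicate_prime: "gen_sum (replicate_mset (p i) i) = y i"
  using prime_gt_0_nat[OF prime_p[of i]] by (simp add: gen_sum_def gen_def)

lemma y_in_span: "y i \<in> span"
  unfolding span_def by (rule range_eqI[of _ _ "replicate_mset (p i) i"])
    (simp add: gen_sum_replicate_prime)

lemma gen_integral:
  assumes "i \<noteq> j"
  shows "integral_at (p j) (gen i)"
proof -
  have "\<not> p j dvd p i"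
    using assms inj_p prime_p primes_dvd_imp_eq by (metis injD)
  then have "integral_at (p j) (1 / of_nat (p i))"
    unfolding integral_at_def by (intro exI[of _ 1] exI[of _ "int (p i)"]) auto
  then show ?thesis
    using integral_at_mult[OF prime_p[of j] y_integral[of j i], of "1 / of_nat (p i)"]
    by (simp add: gen_def)
qed

lemma gen_sum_integral:
  assumes "j \<notin># X"
  shows "integral_at (p j) (gen_sum X)"
  using assms
proof (induction X)
  case empty
  then show ?case
    using integral_at_of_int[OF prime_p, of j 0] by simp
next
  case (add i X)
  then show ?case
    using integral_at_add[OF prime_p gen_integral] by auto
qed

text \<open>
  All summands other than \<open>gen j\<close> are integral at \<open>p j\<close>, so integrality at \<open>p j\<close> of the sum is
  decided by the multiple of \<open>y j / p j\<close> alone, and \<open>y j\<close> is a unit at \<open>p j\<close>.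
\<close>

lemma prime_dvd_count:
  assumes "integral_at (p j) (gen_sum X)"
  shows "p j dvd count X j"
proof -
  define Z where "Z = filter_mset (\<lambda>i. i \<noteq> j) X"
  have "X = replicate_mset (count X j) j + Z"
    unfolding Z_def by (rule multiset_eqI) auto
  then have "gen_sum X = of_nat (count X j) * gen j + gen_sum Z"
    by (metis gen_sum_simps(2) gen_sum_def image_replicate_mset sum_mset_replicate_mset)
  moreover have "integral_at (p j) (gen_sum Z)"
    by (rule gen_sum_integral) (simp add: Z_def)
  ultimately have "integral_at (p j) (of_nat (count X j) * gen j)"
    using integral_at_diff[OF prime_p assms, of "gen_sum Z"] by simp
  then have "integral_at (p j) (of_nat (count X j) * gen j * inverse (y j))"
    using integral_at_mult[OF prime_p _ inverse_y_integral] by blast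
  also have "of_nat (count X j) * gen j * inverse (y j) = of_nat (count X j) / of_nat (p j)"
    using y_pos[of j] by (simp add: gen_def field_simps)
  finally show ?thesis
    by (simp add: integral_at_of_nat_divide[OF prime_p])
qed

text \<open>
  A sum equal to \<open>gen i\<close> is not integral at \<open>p i\<close> and hence has \<open>gen i\<close> as a summand.
  As all generators are positive, there is nothing else in the sum.
\<close>

lemma gen_atom: "monoid_atom (puiseux span) (gen i)"
proof -
  have split: "r = 0 \<or> s = 0" if mem: "r \<in> span" "s \<in> span" and rs: "gen i = r + s" for r s
  proof -
    obtain X Y where XY: "r = gen_sum X" "s = gen_sum Y"
      using mem unfolding span_def by blast
    have sum: "gen_sum (X + Y) = gen i"
      using rs XY by simp
    have "\<not> integral_at (p i) (gen i)"
      using prime_dvd_count[of i "{#i#}"] prime_p[of i] by auto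
    then have "i \<in># X + Y"
      using gen_sum_integral sum by metis
    then obtain Z where Z: "X + Y = add_mset i Z"
      by (meson multi_member_split)
    then have "Z = {#}"
      using sum gen_sum_eq_0_iff[of Z] by simp
    then have "X = {#} \<or> Y = {#}"
      using Z by (auto simp: union_is_single)
    then show ?thesis
      using XY by auto
  qed
  then show ?thesis
    using gen_in_span[of i] gen_pos[of i]
    unfolding monoid_atom_def Units_puiseux[OF submonoid_span]
    by (auto simp: nonneg_rat_monoid_def)
qed

lemma atomic_span: "atomic_monoid (puiseux span)"
  unfolding atomic_monoid_def
proof
  fix x assume "x \<in> carrier (puiseux span) - Units (puiseux span)"
  then obtain X where X: "x = gen_sum X"
    by (auto simp: span_def)
  obtain xs where "X = mset xs"
    using ex_mset by metis
  moreover have "foldr (+) (map gen xs) 0 = gen_sum (mset xs)"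
    by (induction xs) auto
  ultimately have "x = foldr (\<otimes>\<^bsub>puiseux span\<^esub>) (map gen xs) \<one>\<^bsub>puiseux span\<^esub>"
    using X by (simp add: nonneg_rat_monoid_def)
  then show "\<exists>as. (\<forall>a \<in> set as. monoid_atom (puiseux span) a) \<and>
      x = foldr (\<otimes>\<^bsub>puiseux span\<^esub>) as \<one>\<^bsub>puiseux span\<^esub>"
    using gen_atom by (intro exI[of _ "map gen xs"]) auto
qed

text \<open>
  When all multiplicities are divisible by their primes, blocks of \<open>p j\<close> copies of \<open>gen j\<close>, each
  adding up to \<open>y j\<close>, can be split off until nothing is left.
\<close>

lemma gen_sum_in_closed_set:
  assumes N: "0 \<in> N" "\<And>u v. u \<in> N \<Longrightarrow> v \<in> N \<Longrightarrow> u + v \<in> N" "range y \<subseteq> N"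
    and "\<And>j. p j dvd count X j"
  shows "gen_sum X \<in> N"
  using assms(4)
proof (induction "size X" arbitrary: X rule: less_induct)
  case less
  show ?case
  proof (cases "X = {#}")
    case True
    then show ?thesis
      using N(1) by simp
  next
    case False
    then obtain j where "j \<in># X" by blast
    then have "p j \<le> count X j"
      using less.prems[of j] by (auto intro: dvd_imp_le)
    then have "replicate_mset (p j) j \<subseteq># X"
      by (simp add: count_le_replicate_mset_subset_eq)
    then obtain Z where Z: "X = replicate_mset (p j) j + Z"
      using subset_mset.add_diff_inverse by metis
    have "p i dvd count Z i" for i
      using less.prems[of i] by (cases "i = j") (auto simp: Z)
    moreover have "size Z < size X"
      using prime_gt_0_nat[OF prime_p[of j]] by (simp add: Z)
    ultimately have "gen_sum Z \<in> N"
      using less.hyps by blast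
    moreover have "y j \<in> N"
      using N(3) by blast
    ultimately have "y j + gen_sum Z \<in> N"
      using N(2) by blast
    then show ?thesis
      by (simp add: Z gen_sum_replicate_prime)
  qed
qed

text \<open>
  This transfers the absence of maximal common divisors from \<open>N\<close> to the span: the first
  alternative contradicts maximality of \<open>d\<close> outright, and the second leaves a question about \<open>N\<close>.
\<close>

lemma common_divisor_cases:
  assumes N: "0 \<in> N" "\<And>u v. u \<in> N \<Longrightarrow> v \<in> N \<Longrightarrow> u + v \<in> N" "range y \<subseteq> N"
    and ab: "\<And>j. integral_at (p j) a" "\<And>j. integral_at (p j) b"
    and d: "d \<in> span" "a - d \<in> span" "b - d \<in> span"
  obtains e where "e \<in> span" "e > 0" "a - d - e \<in> span" "b - d - e \<in> span"
  | "d \<in> N" "a - d \<in> N" "b - d \<in> N"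
proof -
  obtain C E F where C: "d = gen_sum C" and E: "a - d = gen_sum E" and F: "b - d = gen_sum F"
    using d by (auto simp: span_def)
  show thesis
  proof (cases "\<exists>j. j \<in># E \<and> j \<in># F")
    case True
    then obtain j E' F' where "E = add_mset j E'" "F = add_mset j F'"
      by (meson multi_member_split)
    then have "a - d - gen j \<in> span" "b - d - gen j \<in> span"
      using E F by (simp_all add: span_def)
    then show ?thesis
      using that(1)[of "gen j"] gen_in_span gen_pos by blast
  next
    case False
    have "p j dvd count C j \<and> p j dvd count E j \<and> p j dvd count F j" for j
    proof -
      have "gen_sum (C + E) = a" "gen_sum (C + F) = b"
        using C E F by (simp_all add: algebra_simps)
      then have "p j dvd count C j + count E j" "p j dvd count C j + count F j"
        using prime_dvd_count[of j "C + E"] prime_dvd_count[of j "C + F"] ab by simp_all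
      moreover have "count E j = 0 \<or> count F j = 0"
        using False by (auto simp: not_in_iff)
      ultimately show ?thesis
        by (auto simp: dvd_add_left_iff dvd_add_right_iff)
    qed
    then show ?thesis
      using that(2) gen_sum_in_closed_set[OF N] C E F by simp
  qed
qed

end

section \<open>A Puiseux monoid with a pair without maximal common divisor\<close>

definition triadic :: "rat set" where
  "triadic = {of_int m / 3 ^ n | m n. True}"

text \<open>
  The strict inequality in the second coset makes the common divisors \<open>d\<close> of \<open>1\<close> and \<open>3/2\<close>
  satisfy \<open>d < 1\<close> with no largest value, since the triadic numbers are dense. The base \<open>3\<close> keeps
  \<open>1/2\<close> in a nontrivial coset, and leaves infinitely many primes that divide no denominator.
\<close>

definition half_gap :: "rat set" where
  "half_gap = {x. x \<in> triadic \<and> 0 \<le> x \<or> x - 1/2 \<in> triadic \<and> 1/2 < x}"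

lemma triadic_add:
  assumes "x \<in> triadic" "z \<in> triadic"
  shows "x + z \<in> triadic"
proof -
  obtain m n m' n' where "x = of_int m / 3 ^ n" "z = of_int m' / 3 ^ n'"
    using assms by (auto simp: triadic_def)
  then have "x + z = of_int (m * 3 ^ n' + m' * 3 ^ n) / 3 ^ (n + n')"
    by (simp add: add_divide_distrib power_add)
  then show ?thesis
    unfolding triadic_def by blast
qed

lemma triadic_diff:
  assumes "x \<in> triadic" "z \<in> triadic"
  shows "x - z \<in> triadic"
proof -
  obtain m n where "z = of_int m / 3 ^ n"
    using assms by (auto simp: triadic_def)
  then have "- z = of_int (- m) / 3 ^ n"
    by simp
  then have "- z \<in> triadic"
    unfolding triadic_def by blast
  then show ?thesis
    using triadic_add[OF assms(1)] by fastforce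
qed

lemma triadic_third:
  assumes "x \<in> triadic"
  shows "x / 3 \<in> triadic"
proof -
  obtain m n where "x = of_int m / 3 ^ n"
    using assms by (auto simp: triadic_def)
  then have "x / 3 = of_int m / 3 ^ Suc n"
    by simp
  then show ?thesis
    unfolding triadic_def by blast
qed

lemma one_triadic: "1 \<in> triadic"
  unfolding triadic_def by (intro CollectI exI[of _ 1] exI[of _ 0]) auto

lemma zero_triadic: "0 \<in> triadic"
  using triadic_diff[OF one_triadic one_triadic] by simp

lemma half_not_triadic: "1/2 \<notin> triadic"
proof
  assume "1/2 \<in> triadic"
  then obtain m n where "(1/2 :: rat) = of_int m / 3 ^ n"
    by (auto simp: triadic_def)
  then have "of_int (3 ^ n) = (of_int (2 * m) :: rat)"
    by (simp add: field_simps)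
  then have "(3 :: int) ^ n = 2 * m"
    by (simp only: of_int_eq_iff)
  then have "even ((3 :: int) ^ n)"
    by simp
  then show False by simp
qed

lemma half_gap_add:
  assumes "x \<in> half_gap" "z \<in> half_gap"
  shows "x + z \<in> half_gap"
proof -
  consider "x \<in> triadic" "z \<in> triadic" | "x - 1/2 \<in> triadic" "z \<in> triadic"
    | "x \<in> triadic" "z - 1/2 \<in> triadic" | "x - 1/2 \<in> triadic" "z - 1/2 \<in> triadic"
    using assms by (auto simp: half_gap_def)
  then show ?thesis
  proof cases
    case 1
    then show ?thesis
      using assms triadic_add[of x z] by (auto simp: half_gap_def)
  next
    case 2
    then have "x > 1/2" "z \<ge> 0"
      using assms half_not_triadic triadic_diff[of x "x - 1/2"] triadic_diff[of z "z - 1/2"]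
      by (auto simp: half_gap_def)
    then show ?thesis
      using 2 triadic_add[of "x - 1/2" z] by (simp add: half_gap_def algebra_simps)
  next
    case 3
    then have "z > 1/2" "x \<ge> 0"
      using assms half_not_triadic triadic_diff[of x "x - 1/2"] triadic_diff[of z "z - 1/2"]
      by (auto simp: half_gap_def)
    then show ?thesis
      using 3 triadic_add[of x "z - 1/2"] by (simp add: half_gap_def algebra_simps)
  next
    case 4
    then have "x + z \<in> triadic"
      using triadic_add[OF triadic_add[of "x - 1/2" "z - 1/2"] one_triadic] by simp
    then show ?thesis
      using assms by (auto simp: half_gap_def)
  qed
qed

lemma half_gap_integral:
  assumes "prime q" "q > 3" "x \<in> half_gap"
  shows "integral_at q x"
proof -
  have tri: "integral_at q z" if "z \<in> triadic" for z
  proof -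
    obtain m n where mn: "z = of_int m / 3 ^ n"
      using \<open>z \<in> triadic\<close> by (auto simp: triadic_def)
    have "\<not> q dvd 3"
      using assms(2) dvd_imp_le[of q 3] by auto
    then have "\<not> q dvd 3 ^ n"
      using prime_dvd_power[OF assms(1)] by blast
    then have "\<not> int q dvd 3 ^ n"
      by (metis of_nat_dvd_iff of_nat_numeral of_nat_power)
    then show ?thesis
      unfolding integral_at_def mn by (intro exI[of _ m] exI[of _ "3 ^ n"]) auto
  qed
  have "\<not> int q dvd 2"
    using assms by (auto dest: zdvd_imp_le)
  then have "integral_at q (1/2)"
    unfolding integral_at_def by (intro exI[of _ 1] exI[of _ 2]) auto
  then show ?thesis
    using assms tri[of x] integral_at_add[OF assms(1) tri[of "x - 1/2"], of "1/2"]
    unfolding half_gap_def by auto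
qed

lemma half_gap_no_mcd:
  assumes "d \<in> half_gap" "1 - d \<in> half_gap" "3/2 - d \<in> half_gap"
  obtains e where "e \<in> half_gap" "e > 0" "1 - d - e \<in> half_gap" "3/2 - d - e \<in> half_gap"
proof (cases "d \<in> triadic")
  case True
  have "1 - d \<in> triadic"
    using triadic_diff one_triadic True by blast
  have "3/2 - d \<notin> triadic"
  proof
    assume "3/2 - d \<in> triadic"
    then have "3/2 - d + d - 1 \<in> triadic"
      using True triadic_add triadic_diff one_triadic by blast
    then show False
      using half_not_triadic by simp
  qed
  then have "d < 1"
    using assms by (auto simp: half_gap_def)
  \<comment> \<open>Any triadic number strictly between \<open>0\<close> and \<open>1 - d\<close> would do.\<close>
  define e where "e = (1 - d) / 3"
  have "e > 0" "e \<in> triadic"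
    using \<open>d < 1\<close> triadic_third[OF \<open>1 - d \<in> triadic\<close>] by (simp_all add: e_def)
  moreover have "1 - d - e > 0"
    using \<open>d < 1\<close> by (simp add: e_def)
  moreover have "1 - d - e \<in> triadic"
    using triadic_diff \<open>1 - d \<in> triadic\<close> \<open>e \<in> triadic\<close> by blast
  moreover from this have "3/2 - d - e - 1/2 \<in> triadic"
    by (simp add: algebra_simps)
  ultimately have "e \<in> half_gap" "1 - d - e \<in> half_gap" "3/2 - d - e \<in> half_gap"
    unfolding half_gap_def mem_Collect_eq by (blast intro: less_imp_le, blast intro: less_imp_le, simp)
  then show ?thesis
    using that[of e] \<open>e > 0\<close> by blast
next
  case False
  have "1 - d \<notin> triadic"
  proof
    assume "1 - d \<in> triadic"
    then have "1 - (1 - d) \<in> triadic"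
      using triadic_diff one_triadic by blast
    then show False
      using False by simp
  qed
  then have "1/2 < d" "1/2 < 1 - d"
    using assms False by (auto simp: half_gap_def)
  then show ?thesis by simp
qed

section \<open>The atomic Puiseux monoid\<close>

lemma primes_above:
  fixes B :: "nat \<Rightarrow> nat"
  obtains p :: "nat \<Rightarrow> nat" where "inj p" "\<And>i. prime (p i)" "\<And>i. p i > B i"
proof -
  have "\<exists>p. \<forall>n. (prime (p n) \<and> p n > B n) \<and> p n < p (Suc n)"
  proof (rule dependent_nat_choice)
    show "\<exists>q. prime q \<and> B 0 < q"
      using bigger_prime by blast
    fix q n
    show "\<exists>q'. (prime q' \<and> B (Suc n) < q') \<and> q < q'"
      using bigger_prime[of "max q (B (Suc n))"] by auto
  qed
  then show ?thesis
    using that strict_mono_imp_inj_on[of _ UNIV] strict_mono_Suc_iff by blast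
qed

theorem mainTheorem2:
  shows "\<exists>M. puiseux_monoid M \<and> atomic_monoid M \<and> \<not> atomic_monoid (power_monoid M)"
proof -
  have pair: "1 \<in> half_gap - {0}" "3/2 \<in> half_gap - {0}"
    using one_triadic by (simp_all add: half_gap_def)
  define y where "y = from_nat_into (half_gap - {0})"
  have range_y: "range y = half_gap - {0}"
    unfolding y_def using pair by (intro range_from_nat_into) auto
  then have "y i \<in> half_gap" "y i \<noteq> 0" for i
    by auto
  moreover have "x \<ge> 0" if "x \<in> half_gap" for x
    using that by (auto simp: half_gap_def)
  ultimately have y: "y i \<in> half_gap" "y i > 0" for i
    by (simp_all add: order_less_le)
  obtain p where p: "inj p" "\<And>i. prime (p i)"
    "\<And>i. p i > max 3 (nat (fst (quotient_of (y i))))"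
    using primes_above[of "\<lambda>i. max 3 (nat (fst (quotient_of (y i))))"] by blast
  have p_integral: "integral_at (p j) x" if "x \<in> half_gap" for j x
    using half_gap_integral[OF p(2) _ that] p(3)[of j] by simp
  have "\<not> int (p i) dvd fst (quotient_of (y i))" for i
  proof -
    have "fst (quotient_of (y i)) > 0"
      using y(2)[of i] by (metis quotient_of_div quotient_of_denom_pos' prod.collapse
          zero_less_divide_iff of_int_0_less_iff order.asym)
    then show ?thesis
      using p(3)[of i] by (auto dest: zdvd_imp_le)
  qed
  then interpret prime_divided_generators y p
    using p y p_integral integral_at_inverse by unfold_locales auto

  have "\<not> atomic_monoid (power_monoid (puiseux span))"
  proof
    assume atomic: "atomic_monoid (power_monoid (puiseux span))"
    have "1 \<in> span" "3/2 \<in> span"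
      using pair range_y y_in_span by (metis imageE)+
    then have "{1, 3/2} \<in> carrier (power_monoid (puiseux span))"
      by (simp add: power_monoid_def)
    moreover have "{1, 3/2} \<notin> Units (power_monoid (puiseux span))"
      by (auto simp: Units_power_puiseux[OF submonoid_span])
    ultimately obtain As where As: "\<forall>A \<in> set As. monoid_atom (power_monoid (puiseux span)) A"
      "{1, 3/2} = foldr (\<otimes>\<^bsub>power_monoid (puiseux span)\<^esub>) As \<one>\<^bsub>power_monoid (puiseux span)\<^esub>"
      using atomic unfolding atomic_monoid_def by blast
    obtain d where d: "d \<in> span" "1 - d \<in> span" "3/2 - d \<in> span"
      and max: "\<And>e. e \<in> span \<Longrightarrow> 1 - d - e \<in> span \<Longrightarrow> 3/2 - d - e \<in> span \<Longrightarrow> e = 0"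
      using pair_sum_of_atoms_imp_mcd[OF submonoid_span As] by auto
    have zero: "0 \<in> half_gap"
      using zero_triadic by (simp add: half_gap_def)
    have half_gap_span: "x \<in> span" if "x \<in> half_gap" for x
      using that range_y y_in_span gen_sum_simps(1) unfolding span_def
      by (cases "x = 0") (metis rangeI, metis DiffI imageE singletonD)
    have "range y \<subseteq> half_gap" "1 \<in> half_gap" "3/2 \<in> half_gap"
      using range_y pair by auto
    note cases = common_divisor_cases[OF zero half_gap_add this(1)
        p_integral[OF this(2)] p_integral[OF this(3)] d]
    show False
    proof (rule cases)
      show False if "e \<in> span" "e > 0" "1 - d - e \<in> span" "3/2 - d - e \<in> span" for e
        using max[of e] that by simp
      assume "d \<in> half_gap" "1 - d \<in> half_gap" "3/2 - d \<in> half_gap"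
      then obtain e where "e \<in> half_gap" "e > 0" "1 - d - e \<in> half_gap" "3/2 - d - e \<in> half_gap"
        by (rule half_gap_no_mcd)
      then show False
        using max[of e] half_gap_span by simp
    qed
  qed
  moreover have "puiseux_monoid (puiseux span)"
    using submonoid_span unfolding puiseux_monoid_def by blast
  ultimately show ?thesis
    using atomic_span by blast
qed

end
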